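(* Let $n\geq 1$ and $s \in \{1,2\}$. If $\mathcal{A} \subset 2^{[n]}$ is a collection of even-sized subsets of $[n]$ with $|\mathcal{A}| \geq 2^{\lfloor n/2 \rfloor}+s$, then $\mathrm{op}(\mathcal{A}) \geq s \cdot 2^{\lfloor n/2 \rfloor-1}$.
   Context: $[n]=\{1,\ldots,n\}$ and $2^{[n]}$ denotes the collection of all subsets of $[n]$. For a collection $\mathcal{A}$ of sets, $\mathrm{op}(\mathcal{A})$ denotes the number of unordered pairs of distinct sets $A,B\in\mathcal{A}$ for which $|A\cap B|$ is odd. *)

theory Defs
  imports Complex_Main
begin

definition op_count :: "'a set set \<Rightarrow> nat" where
  "op_count \<A> = card {{A, B} | A B. A \<in> \<A> \<and> B \<in> \<A> \<and> A \<noteq> B \<and> odd (card (A \<inter> B))}"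

end

theory Submission
  imports Defs
begin

text \<open>Call two sets orthogonal if their intersection has even size; this is the standard bilinear
  form on \<open>\<bbbF>\<^sub>2\<^sup>n\<close>, and by eventown a pairwise orthogonal family has at most \<open>2\<^sup>k\<close> members,
  \<open>k = \<lfloor>n/2\<rfloor>\<close>. Let \<open>K = 2\<^bsup>k-1\<^esup>\<close> and suppose that a family of \<open>2K + s\<close> even sets has fewer than
  \<open>s K\<close> odd pairs. Deleting \<open>r\<close> members of degree at least two leaves a family \<open>Z\<close> of isolated members
  and an induced matching of \<open>m\<close> odd pairs with \<open>2r + m < s K\<close>. One end of each pair can be
  added to the span of \<open>Z\<close>, so \<open>2\<^sup>m |Z| \<le> 2\<^sup>k\<close>, and counting forces \<open>m = 0\<close> and \<open>|Z| \<ge> K + s\<close>.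
  Let \<open>U\<close> be a maximal isotropic family containing \<open>Z\<close>. An even set outside \<open>U\<close> is orthogonal
  to at most \<open>K\<close> members of \<open>U\<close>, since those members can be translated by it. If \<open>u\<close> members of the
  family lie in \<open>U\<close>, there are thus at least \<open>(2K + s - u)(u - K) \<ge> s K\<close> odd pairs.\<close>

section \<open>Parity form and isotropic families\<close>

text \<open>Allowing \<open>A = B\<close> forces finite members to be even, so these are the
  self-orthogonal sets of vectors.\<close>

definition isotropic :: "'a set set \<Rightarrow> bool" where
  "isotropic S \<longleftrightarrow> (\<forall>A\<in>S. \<forall>B\<in>S. even (card (A \<inter> B)))"

definition odd_pairs :: "'a set set \<Rightarrow> 'a set set set" where
  "odd_pairs \<A> = {{A, B} | A B. A \<in> \<A> \<and> B \<in> \<A> \<and> A \<noteq> B \<and> odd (card (A \<inter> B))}"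

lemma op_count_eq_card_odd_pairs: "op_count \<A> = card (odd_pairs \<A>)"
  by (simp add: op_count_def odd_pairs_def)

lemma finite_subset_Pow: "finite X \<Longrightarrow> S \<subseteq> Pow X \<Longrightarrow> finite S"
  using finite_subset[of S "Pow X"] by simp

lemma isotropicD: "isotropic S \<Longrightarrow> A \<in> S \<Longrightarrow> B \<in> S \<Longrightarrow> even (card (A \<inter> B))"
  by (simp add: isotropic_def)

lemma isotropic_subset: "isotropic S \<Longrightarrow> T \<subseteq> S \<Longrightarrow> isotropic T"
  by (auto simp: isotropic_def)

text \<open>Additivity mod 2 of the form in its first argument: the part
  \<open>A \<inter> B \<inter> C\<close>, absent on the left, is counted twice on the right.\<close>

lemma even_card_sym_diff_Int:
  assumes "finite A" "finite B"
  shows "even (card (sym_diff A B \<inter> C)) \<longleftrightarrow> (even (card (A \<inter> C)) \<longleftrightarrow> even (card (B \<inter> C)))"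
proof -
  have "card (A \<inter> C) = card ((A - B) \<inter> C) + card (A \<inter> B \<inter> C)"
    by (subst card_Un_disjoint[symmetric]) (use assms in \<open>auto intro: arg_cong[where f = card]\<close>)
  moreover have "card (B \<inter> C) = card ((B - A) \<inter> C) + card (A \<inter> B \<inter> C)"
    by (subst card_Un_disjoint[symmetric]) (use assms in \<open>auto intro: arg_cong[where f = card]\<close>)
  moreover have "card (sym_diff A B \<inter> C) = card ((A - B) \<inter> C) + card ((B - A) \<inter> C)"
    by (subst card_Un_disjoint[symmetric]) (use assms in \<open>auto intro: arg_cong[where f = card]\<close>)
  ultimately show ?thesis by presburger
qed

lemma inj_sym_diff: "inj (\<lambda>A. sym_diff A B)"
  by (rule injI) blast

text \<open>By bilinearity, pairing two translates gives four even terms, among them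
  \<open>a\<close> with itself. This is the doubling step, both for matched pairs and for sets
  outside a maximal isotropic family.\<close>

lemma isotropic_Un_translate:
  assumes "isotropic F" "\<forall>A\<in>F. finite A" "finite a" "even (card a)"
    and "\<forall>A\<in>F. even (card (A \<inter> a))"
  shows "isotropic (F \<union> (\<lambda>A. sym_diff A a) ` F)"
proof -
  have aF: "even (card (a \<inter> A))" if "A \<in> F" for A
    using assms(5) that by (simp add: Int_commute)
  have FF: "even (card (A \<inter> B))" if "A \<in> F" "B \<in> F" for A B
    using assms(1) that by (auto simp: isotropic_def)
  have l: "even (card (sym_diff A a \<inter> B))" if "A \<in> F" "B \<in> F" for A B
    using that assms(2,3) FF aF by (simp add: even_card_sym_diff_Int)
  have l': "even (card (B \<inter> sym_diff A a))" if "A \<in> F" "B \<in> F" for A B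
    using l[OF that] by (simp only: Int_commute)
  have la: "even (card (a \<inter> sym_diff A a))" if "A \<in> F" for A
    using that assms(2-5) by (subst Int_commute) (simp add: even_card_sym_diff_Int)
  have lr: "even (card (sym_diff A a \<inter> sym_diff B a))" if "A \<in> F" "B \<in> F" for A B
    by (subst even_card_sym_diff_Int) (use that assms(2,3) l' la in auto)
  show ?thesis
    unfolding isotropic_def using FF l l' lr by blast
qed

section \<open>Character sums and the eventown bound\<close>

text \<open>Orthogonality of the characters of the group \<open>Pow X\<close>. If \<open>i\<close>
  lies in exactly one of \<open>A\<close>, \<open>B\<close>, toggling \<open>i\<close> in
  \<open>C\<close> is an involution that negates every summand.\<close>

lemma sum_Pow_character:
  assumes "finite X" "A \<subseteq> X" "B \<subseteq> X"
  shows "(\<Sum>C\<in>Pow X. (-1) ^ card (A \<inter> C) * (-1) ^ card (B \<inter> C)) =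
    (if A = B then 2 ^ card X else (0::int))"
proof (cases "A = B")
  case True
  then show ?thesis
    using assms by (simp add: card_Pow flip: power_mult_distrib)
next
  case False
  then obtain i where i: "i \<in> sym_diff A B" by blast
  let ?f = "\<lambda>C. (-1) ^ card (A \<inter> C) * (-1) ^ card (B \<inter> C) :: int"
  have flip: "?f (sym_diff C {i}) = - ?f C" if "C \<subseteq> X" for C
  proof -
    have "finite C" by (rule finite_subset[OF _ assms(1)]) (use that assms(2) in auto)
    then have "even (card (D \<inter> sym_diff C {i})) \<longleftrightarrow> (even (card (D \<inter> C)) \<longleftrightarrow> i \<notin> D)" for D
      using even_card_sym_diff_Int[of C "{i}" D] by (cases "i \<in> D") (simp_all add: Int_commute)
    then show ?thesis
      using i by (auto simp: minus_one_power_iff)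
  qed
  have "sum ?f (Pow X) = sum (\<lambda>C. ?f (sym_diff C {i})) (Pow X)"
    by (rule sum.reindex_bij_witness[of _ "\<lambda>C. sym_diff C {i}" "\<lambda>C. sym_diff C {i}"])
      (use i assms in \<open>auto intro!: arg_cong2[where f = "(*)"] arg_cong[where f = "\<lambda>S. (-1) ^ card S"]\<close>)
  also have "\<dots> = - sum ?f (Pow X)"
    unfolding sum_negf[symmetric] by (rule sum.cong[OF refl]) (use flip in blast)
  finally show ?thesis using False by simp
qed

text \<open>\<open>f\<close> is the Fourier transform of the indicator of \<open>S\<close>. It
  equals \<open>card S\<close> throughout \<open>T\<close>, while by Parseval its squares sum to
  \<open>card S * 2 ^ card X\<close>.\<close>

lemma card_mult_orthogonal_le:
  assumes "finite X" "S \<subseteq> Pow X" "T \<subseteq> Pow X" "S \<noteq> {}"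
    and "\<forall>A\<in>S. \<forall>B\<in>T. even (card (A \<inter> B))"
  shows "card S * card T \<le> 2 ^ card X"
proof -
  have fin: "finite S" "finite T"
    using assms(1-3) finite_subset_Pow by blast+
  define f where "f C = (\<Sum>A\<in>S. (-1) ^ card (A \<inter> C) :: int)" for C
  have "int (card T) * (int (card S))\<^sup>2 = (\<Sum>C\<in>T. (f C)\<^sup>2)"
    using assms(5) by (simp add: f_def)
  also have "\<dots> \<le> (\<Sum>C\<in>Pow X. (f C)\<^sup>2)"
    using assms by (intro sum_mono2) auto
  also have "\<dots> = (\<Sum>C\<in>Pow X. \<Sum>A\<in>S. \<Sum>B\<in>S. (-1) ^ card (A \<inter> C) * (-1) ^ card (B \<inter> C))"
    by (simp add: f_def power2_eq_square sum_product)
  also have "\<dots> = (\<Sum>A\<in>S. \<Sum>B\<in>S. \<Sum>C\<in>Pow X. (-1) ^ card (A \<inter> C) * (-1) ^ card (B \<inter> C))"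
    by (subst sum.swap, rule sum.cong[OF refl], rule sum.swap)
  also have "\<dots> = (\<Sum>A\<in>S. \<Sum>B\<in>S. if A = B then 2 ^ card X else 0)"
    by (intro sum.cong refl sum_Pow_character) (use assms in auto)
  also have "\<dots> = int (card S) * 2 ^ card X"
    using fin by simp
  finally have "int (card S) * (int (card S) * int (card T)) \<le> int (card S) * 2 ^ card X"
    by (simp add: power2_eq_square algebra_simps)
  moreover have "int (card S) > 0"
    using assms(4) fin by (simp add: card_gt_0_iff)
  ultimately have "int (card S * card T) \<le> int (2 ^ card X)"
    by simp
  then show ?thesis by linarith
qed

text \<open>When \<open>card X\<close> is odd, \<open>S\<close> is also orthogonal to the complements of its members, which
  gains the factor needed for the floor in the exponent.\<close>

theorem eventown:
  assumes "finite X" "S \<subseteq> Pow X" "isotropic S"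
  shows "card S \<le> 2 ^ (card X div 2)"
proof (cases "S = {}")
  case False
  have ev: "even (card (A \<inter> B))" if "A \<in> S" "B \<in> S" for A B
    using assms(3) that by (simp add: isotropic_def)
  have evc: "even (card A)" if "A \<in> S" for A
    using ev[OF that that] by simp
  have fin: "finite S"
    using assms(1,2) finite_subset_Pow by blast
  have "card S * card S \<le> 2 ^ (2 * (card X div 2))"
  proof (cases "even (card X)")
    case True
    then show ?thesis
      using card_mult_orthogonal_le[OF assms(1,2,2) False] ev by simp
  next
    case odd: False
    let ?c = "\<lambda>A. X - A"
    have sub: "?c ` S \<subseteq> Pow X" by blast
    have "inj_on ?c S" using assms(2) by (auto simp: inj_on_def)
    have "S \<inter> ?c ` S = {}"
    proof (rule ccontr)
      assume "S \<inter> ?c ` S \<noteq> {}"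
      then obtain A where A: "A \<in> S" "X - A \<in> S" by blast
      then have "card (X - A) + card A = card X"
        using assms by (metis Pow_iff card_Diff_subset card_mono finite_subset le_add_diff_inverse2 subsetD)
      then show False using evc[OF A(1)] evc[OF A(2)] odd by presburger
    qed
    then have "card (S \<union> ?c ` S) = 2 * card S"
      using fin \<open>inj_on ?c S\<close> by (simp add: card_Un_disjoint card_image)
    moreover have "even (card (A \<inter> (X - B)))" if "A \<in> S" "B \<in> S" for A B
    proof -
      have "finite A" by (rule finite_subset[OF _ assms(1)]) (use that assms(2) in auto)
      have "A \<inter> (X - B) = A - A \<inter> B" using that assms by blast
      then have "card (A \<inter> (X - B)) = card A - card (A \<inter> B)"
        using \<open>finite A\<close> by (simp add: card_Diff_subset)
      then show ?thesis using ev[OF that] evc[OF that(1)] by simp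
    qed
    then have "\<forall>A\<in>S. \<forall>B\<in>S \<union> ?c ` S. even (card (A \<inter> B))"
      using ev by blast
    ultimately have "card S * (2 * card S) \<le> 2 ^ card X"
      using card_mult_orthogonal_le[OF assms(1,2), of "S \<union> ?c ` S"] False sub assms(2) by simp
    moreover have "card X = Suc (2 * (card X div 2))" using odd by presburger
    ultimately show ?thesis
      by (metis mult.left_commute mult_le_cancel1 power_Suc zero_less_numeral)
  qed
  then have "(card S)\<^sup>2 \<le> (2 ^ (card X div 2))\<^sup>2"
    by (simp add: power2_eq_square power_add[symmetric] mult_2)
  then show ?thesis
    using power2_le_imp_le by blast
qed simp

section \<open>Counting odd pairs; reduction to isolated members and an induced matching\<close>

lemma finite_odd_pairs: "finite \<A> \<Longrightarrow> finite (odd_pairs \<A>)"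
  by (rule finite_subset[of _ "Pow \<A>"]) (auto simp: odd_pairs_def)

lemma op_count_mono:
  assumes "finite \<B>" "\<A> \<subseteq> \<B>"
  shows "op_count \<A> \<le> op_count \<B>"
  unfolding op_count_eq_card_odd_pairs
  by (rule card_mono[OF finite_odd_pairs[OF assms(1)]]) (use assms(2) in \<open>auto simp: odd_pairs_def\<close>)

text \<open>Pairs through \<open>A\<close> correspond to its odd partners and are disjoint from the
  pairs avoiding \<open>A\<close>. Used with \<open>d = 2\<close> for deletions and
  \<open>d = 1\<close> for a matched pair.\<close>

lemma op_count_remove:
  assumes "finite \<A>" "A \<in> \<A>" "d \<le> card {B \<in> \<A>. B \<noteq> A \<and> odd (card (A \<inter> B))}"
  shows "op_count (\<A> - {A}) + d \<le> op_count \<A>"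
proof -
  let ?N = "{B \<in> \<A>. B \<noteq> A \<and> odd (card (A \<inter> B))}"
  have "inj_on (\<lambda>B. {A, B}) ?N"
    by (auto simp: inj_on_def doubleton_eq_iff)
  then have "op_count (\<A> - {A}) + card ?N = card (odd_pairs (\<A> - {A}) \<union> (\<lambda>B. {A, B}) ` ?N)"
    unfolding op_count_eq_card_odd_pairs
    by (subst card_Un_disjoint) (use assms in \<open>auto simp: finite_odd_pairs card_image, auto simp: odd_pairs_def doubleton_eq_iff\<close>)
  also have "\<dots> \<le> card (odd_pairs \<A>)"
    by (rule card_mono[OF finite_odd_pairs[OF assms(1)]]) (use assms(2) in \<open>auto simp: odd_pairs_def\<close>)
  finally show ?thesis using assms(3) unfolding op_count_eq_card_odd_pairs by (meson add_left_mono order.trans)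
qed

text \<open>A pair with one end in \<open>\<B>\<close> and one outside determines which end is
  which, so summing degrees counts no pair twice.\<close>

lemma op_count_ge_cross_degrees:
  assumes "finite \<A>" "\<B> \<subseteq> \<A>"
    and "\<And>A. A \<in> \<A> - \<B> \<Longrightarrow> d \<le> card {B \<in> \<B>. odd (card (A \<inter> B))}"
  shows "card (\<A> - \<B>) * d \<le> op_count \<A>"
proof -
  have finB: "finite \<B>" using assms finite_subset by blast
  let ?P = "SIGMA A:\<A> - \<B>. {B \<in> \<B>. odd (card (A \<inter> B))}"
  have "card (\<A> - \<B>) * d \<le> (\<Sum>A\<in>\<A> - \<B>. card {B \<in> \<B>. odd (card (A \<inter> B))})"
    using sum_mono[of "\<A> - \<B>" "\<lambda>_. d"] assms(3) by simp
  also have "\<dots> = card ?P"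
    using assms finB by (subst card_SigmaI) auto
  also have "\<dots> = card ((\<lambda>(A, B). {A, B}) ` ?P)"
    by (rule card_image[symmetric]) (auto simp: inj_on_def doubleton_eq_iff)
  also have "\<dots> \<le> card (odd_pairs \<A>)"
    by (rule card_mono[OF finite_odd_pairs[OF assms(1)]]) (use assms(2) in \<open>auto simp: odd_pairs_def\<close>)
  finally show ?thesis by (simp add: op_count_eq_card_odd_pairs)
qed

text \<open>If every degree is at most one, the odd pairs \<open>(a\<^sub>i, b\<^sub>i)\<close> are mutually orthogonal, and
  \<open>F\<close> is the sum of \<open>insert {} Z\<close> with the span of the \<open>a\<^sub>i\<close>; the \<open>b\<^sub>i\<close> witness that this sum
  is direct. Inserting \<open>{}\<close> bounds \<open>m\<close> even when \<open>Z\<close> is empty.\<close>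

lemma induced_matching_isotropic:
  assumes "finite \<A>" "\<A> \<subseteq> Pow X" "finite X" "\<forall>A\<in>\<A>. even (card A)"
    and "\<forall>A\<in>\<A>. card {B \<in> \<A>. B \<noteq> A \<and> odd (card (A \<inter> B))} \<le> 1"
  shows "\<exists>m Z F. m \<le> op_count \<A> \<and> Z \<subseteq> \<A> \<and> isotropic Z \<and> card Z + 2 * m = card \<A> \<and>
    F \<subseteq> Pow X \<and> isotropic F \<and> card F = 2 ^ m * card (insert {} Z) \<and>
    (\<forall>C. (\<forall>A\<in>\<A>. even (card (A \<inter> C))) \<longrightarrow> (\<forall>A\<in>F. even (card (A \<inter> C))))"
  using assms
proof (induction "card \<A>" arbitrary: \<A> rule: less_induct)
  case less
  show ?case
  proof (cases "isotropic \<A>")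
    case True
    then show ?thesis
      using less.prems(2)
      by (intro exI[of _ 0] exI[of _ \<A>] exI[of _ "insert {} \<A>"] conjI) (simp_all add: isotropic_def)
  next
    case False
    then obtain a b where ab: "a \<in> \<A>" "b \<in> \<A>" "odd (card (a \<inter> b))"
      by (auto simp: isotropic_def)
    then have "a \<noteq> b" using less.prems(4) by auto
    have ba: "odd (card (b \<inter> a))" using ab(3) by (simp add: Int_commute)
    let ?B = "\<A> - {a, b}"
    have uniq: "C = D" if "A \<in> \<A>" "C \<in> \<A>" "C \<noteq> A" "odd (card (A \<inter> C))"
      "D \<in> \<A>" "D \<noteq> A" "odd (card (A \<inter> D))" for A C D
    proof -
      have "card {B \<in> \<A>. B \<noteq> A \<and> odd (card (A \<inter> B))} \<le> Suc 0"
        using less.prems(5) that(1) by simp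
      then show ?thesis
        using that less.prems(1) by (subst (asm) card_le_Suc0_iff_eq) auto
    qed
    have orth_a: "even (card (A \<inter> a))" if "A \<in> ?B" for A
      using uniq[OF ab(1,2) \<open>a \<noteq> b\<close>[symmetric] ab(3), of A] that by (subst Int_commute) blast
    have orth_b: "even (card (A \<inter> b))" if "A \<in> ?B" for A
      using uniq[OF ab(2,1) \<open>a \<noteq> b\<close> ba, of A] that by (subst Int_commute) blast
    have cA: "card \<A> = card ?B + 2"
      using ab \<open>a \<noteq> b\<close> less.prems(1) card_Diff_subset[of "{a, b}" \<A>] card_mono[of \<A> "{a, b}"] by auto
    have deg: "card {B \<in> ?B. B \<noteq> A \<and> odd (card (A \<inter> B))} \<le> 1" if "A \<in> ?B" for A
    proof -
      have "card {B \<in> ?B. B \<noteq> A \<and> odd (card (A \<inter> B))} \<le> card {B \<in> \<A>. B \<noteq> A \<and> odd (card (A \<inter> B))}"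
        using less.prems(1) by (intro card_mono) auto
      also have "\<dots> \<le> 1" using less.prems(5) that by blast
      finally show ?thesis .
    qed
    have "\<exists>m Z F. m \<le> op_count ?B \<and> Z \<subseteq> ?B \<and> isotropic Z \<and> card Z + 2 * m = card ?B \<and>
      F \<subseteq> Pow X \<and> isotropic F \<and> card F = 2 ^ m * card (insert {} Z) \<and>
      (\<forall>C. (\<forall>A\<in>?B. even (card (A \<inter> C))) \<longrightarrow> (\<forall>A\<in>F. even (card (A \<inter> C))))"
    proof (rule less.hyps)
      show "card ?B < card \<A>" using cA by simp
      show "finite ?B" "?B \<subseteq> Pow X" "finite X" "\<forall>A\<in>?B. even (card A)"
        using less.prems(1-4) by auto
      show "\<forall>A\<in>?B. card {B \<in> ?B. B \<noteq> A \<and> odd (card (A \<inter> B))} \<le> 1"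
        using deg by blast
    qed
    then obtain m Z F where IH: "m \<le> op_count ?B" "Z \<subseteq> ?B" "isotropic Z"
      "card Z + 2 * m = card ?B" "F \<subseteq> Pow X" "isotropic F" "card F = 2 ^ m * card (insert {} Z)"
      and gen': "\<forall>C. (\<forall>A\<in>?B. even (card (A \<inter> C))) \<longrightarrow> (\<forall>A\<in>F. even (card (A \<inter> C)))"
      by (elim exE conjE)
    \<comment> \<open>Dual form of \<open>F\<close> lying in the span of \<open>?B\<close>: whatever
      is orthogonal to \<open>?B\<close> is orthogonal to \<open>F\<close>. It is applied to
      \<open>a\<close> and \<open>b\<close>.\<close>
    have gen: "even (card (A \<inter> C))" if "\<forall>A\<in>?B. even (card (A \<inter> C))" "A \<in> F" for A C
      using gen'[THEN spec, THEN mp, OF that(1)] that(2) by (rule bspec)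
    let ?F = "F \<union> (\<lambda>A. sym_diff A a) ` F"
    have fin: "finite A" if "A \<in> F \<or> A \<in> \<A>" for A
      by (rule finite_subset[OF _ less.prems(3)]) (use that IH(5) less.prems(2) in auto)
    have finF: "finite F" using IH(5) less.prems(3) finite_subset_Pow by blast
    have Fa: "even (card (A \<inter> a))" if "A \<in> F" for A using gen[of a] orth_a that by blast
    have Fb: "even (card (A \<inter> b))" if "A \<in> F" for A using gen[of b] orth_b that by blast
    have isoF: "isotropic ?F"
      by (rule isotropic_Un_translate[OF IH(6)]) (use fin Fa ab less.prems(4) in auto)
    have cardF: "card ?F = 2 * card F"
    proof -
      have "odd (card (sym_diff A a \<inter> b))" if "A \<in> F" for A
        using that Fb ab(1,3) fin by (simp add: even_card_sym_diff_Int)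
      then have "F \<inter> (\<lambda>A. sym_diff A a) ` F = {}" using Fb by blast
      then show ?thesis
        using finF by (simp add: card_Un_disjoint card_image inj_on_subset[OF inj_sym_diff])
    qed
    have subF: "?F \<subseteq> Pow X" using IH(5) ab(1) less.prems(2) by blast
    have genF: "even (card (A \<inter> C))" if C: "\<forall>A\<in>\<A>. even (card (A \<inter> C))" and A: "A \<in> ?F" for A C
    proof -
      have F: "even (card (A \<inter> C))" if "A \<in> F" for A using gen[of C] C that by blast
      then have "even (card (sym_diff A a \<inter> C))" if "A \<in> F" for A
        using that C ab(1) fin by (simp add: even_card_sym_diff_Int)
      then show ?thesis using A F by blast
    qed
    have opF: "Suc m \<le> op_count \<A>"
    proof -
      have "b \<in> {B \<in> \<A>. B \<noteq> a \<and> odd (card (a \<inter> B))}" using ab \<open>a \<noteq> b\<close> by auto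
      then have "Suc 0 \<le> card {B \<in> \<A>. B \<noteq> a \<and> odd (card (a \<inter> B))}"
        unfolding Suc_le_eq using less.prems(1) by (subst card_gt_0_iff) auto
      from op_count_remove[OF less.prems(1) ab(1) this]
      have "Suc (op_count (\<A> - {a})) \<le> op_count \<A>" by simp
      moreover have "op_count ?B \<le> op_count (\<A> - {a})"
        by (rule op_count_mono) (use less.prems(1) in auto)
      ultimately show ?thesis
        using IH(1) by linarith
    qed
    show ?thesis
    proof (rule exI[of _ "Suc m"], rule exI[of _ Z], rule exI[of _ ?F], intro conjI)
      show "Z \<subseteq> \<A>" using IH(2) by blast
      show "card Z + 2 * Suc m = card \<A>" using IH(4) cA by simp
      show "card ?F = 2 ^ Suc m * card (insert {} Z)" using cardF IH(7) by simp
      show "\<forall>C. (\<forall>A\<in>\<A>. even (card (A \<inter> C))) \<longrightarrow> (\<forall>A\<in>?F. even (card (A \<inter> C)))"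
        using genF by blast
    qed (rule opF IH(3) subF isoF)+
  qed
qed

text \<open>Greedy deletion: a member of degree at least two takes at least two odd pairs with
  it.\<close>

lemma remove_high_degree:
  assumes "finite \<A>"
  shows "\<exists>\<B> r. \<B> \<subseteq> \<A> \<and> card \<B> + r = card \<A> \<and> op_count \<B> + 2 * r \<le> op_count \<A> \<and>
    (\<forall>A\<in>\<B>. card {B \<in> \<B>. B \<noteq> A \<and> odd (card (A \<inter> B))} \<le> 1)"
  using assms
proof (induction "card \<A>" arbitrary: \<A> rule: less_induct)
  case less
  show ?case
  proof (cases "\<forall>A\<in>\<A>. card {B \<in> \<A>. B \<noteq> A \<and> odd (card (A \<inter> B))} \<le> 1")
    case True
    then show ?thesis by (intro exI[of _ \<A>] exI[of _ 0]) auto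
  next
    case False
    then obtain A where A: "A \<in> \<A>" "card {B \<in> \<A>. B \<noteq> A \<and> odd (card (A \<inter> B))} \<ge> Suc 1"
      by (meson not_less_eq_eq)
    have c: "card \<A> = Suc (card (\<A> - {A}))"
      using A(1) less.prems by (metis card_Suc_Diff1)
    obtain \<B> r where "\<B> \<subseteq> \<A> - {A}" "card \<B> + r = card (\<A> - {A})"
      "op_count \<B> + 2 * r \<le> op_count (\<A> - {A})"
      "\<forall>A\<in>\<B>. card {B \<in> \<B>. B \<noteq> A \<and> odd (card (A \<inter> B))} \<le> 1"
      using less.hyps[of "\<A> - {A}"] c less.prems by auto
    then show ?thesis
      using c op_count_remove[OF less.prems A]
      by (intro exI[of _ \<B>] exI[of _ "Suc r"]) auto
  qed
qed

text \<open>Here \<open>r\<close> members are deleted, \<open>2 * m\<close> are matched and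
  \<open>Z\<close> is isolated; a deletion costs two odd pairs, a matched pair one. Both power
  bounds are eventown for \<open>F\<close>.\<close>

lemma isotropic_subfamily:
  assumes "finite X" "\<A> \<subseteq> Pow X" "\<forall>A\<in>\<A>. even (card A)"
  obtains r m Z where "2 * r + m \<le> op_count \<A>" "card Z + r + 2 * m = card \<A>"
    "Z \<subseteq> \<A>" "isotropic Z" "2 ^ m * card Z \<le> 2 ^ (card X div 2)" "(2::nat) ^ m \<le> 2 ^ (card X div 2)"
proof -
  have fin: "finite \<A>" using assms(1,2) finite_subset_Pow by blast
  obtain \<B> r where B: "\<B> \<subseteq> \<A>" "card \<B> + r = card \<A>" "op_count \<B> + 2 * r \<le> op_count \<A>"
    "\<forall>A\<in>\<B>. card {B \<in> \<B>. B \<noteq> A \<and> odd (card (A \<inter> B))} \<le> 1"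
    using remove_high_degree[OF fin] by blast
  have finB: "finite \<B>" using B(1) fin finite_subset by blast
  have "\<B> \<subseteq> Pow X" "\<forall>A\<in>\<B>. even (card A)" using B(1) assms by auto
  from induced_matching_isotropic[OF finB this(1) assms(1) this(2) B(4)]
  obtain m Z F where Z: "m \<le> op_count \<B>" "Z \<subseteq> \<B>" "isotropic Z" "card Z + 2 * m = card \<B>"
    "F \<subseteq> Pow X" "isotropic F" "card F = 2 ^ m * card (insert {} Z)"
    by blast
  have finZ: "finite Z" using Z(2) finB finite_subset by blast
  have "2 ^ m * card (insert {} Z) \<le> 2 ^ (card X div 2)"
    using eventown[OF assms(1) Z(5,6)] Z(7) by simp
  moreover have "card Z \<le> card (insert {} Z)" "1 \<le> card (insert {} Z)"
    using finZ by (auto simp: card_insert_if Suc_le_eq card_gt_0_iff)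
  ultimately have "2 ^ m * card Z \<le> 2 ^ (card X div 2)" "(2::nat) ^ m \<le> 2 ^ (card X div 2)"
    by (meson mult_le_mono2 order.trans, metis mult_le_mono2 order.trans mult.right_neutral)
  then show ?thesis
    using that[of r m Z] B Z by auto
qed

section \<open>Maximal isotropic families and the cross count\<close>

lemma maximal_isotropic:
  assumes "finite X" "Z \<subseteq> Pow X" "isotropic Z"
  obtains U where "Z \<subseteq> U" "U \<subseteq> Pow X" "isotropic U"
    "\<And>V. U \<subseteq> V \<Longrightarrow> V \<subseteq> Pow X \<Longrightarrow> isotropic V \<Longrightarrow> V = U"
proof -
  let ?P = "{V. Z \<subseteq> V \<and> V \<subseteq> Pow X \<and> isotropic V}"
  have "finite ?P"
    by (rule finite_subset[of _ "Pow (Pow X)"]) (use assms(1) in auto)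
  moreover have "Z \<in> ?P" using assms by auto
  ultimately have "\<exists>U\<in>?P. \<forall>V\<in>?P. U \<le> V \<longrightarrow> U = V"
    by (intro finite_has_maximal) auto
  then obtain U where U: "U \<in> ?P" and max: "\<And>V. V \<in> ?P \<Longrightarrow> U \<subseteq> V \<Longrightarrow> U = V"
    by auto
  show ?thesis
  proof (rule that[of U])
    fix V assume V: "U \<subseteq> V" "V \<subseteq> Pow X" "isotropic V"
    then have "V \<in> ?P" using U by auto
    then show "V = U" using max V(1) by auto
  qed (use U in auto)
qed

text \<open>The members of \<open>U\<close> orthogonal to \<open>x\<close>, with their translates by
  \<open>x\<close>, form an isotropic family twice as large, to which eventown applies.\<close>

lemma card_orthogonal_maximal_isotropic:
  assumes "finite X" "U \<subseteq> Pow X" "isotropic U"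
    and max: "\<And>V. U \<subseteq> V \<Longrightarrow> V \<subseteq> Pow X \<Longrightarrow> isotropic V \<Longrightarrow> V = U"
    and "x \<subseteq> X" "even (card x)" "x \<notin> U"
  shows "2 * card {u \<in> U. even (card (x \<inter> u))} \<le> 2 ^ (card X div 2)"
proof -
  let ?W = "{u \<in> U. even (card (x \<inter> u))}"
  let ?F = "?W \<union> (\<lambda>A. sym_diff A x) ` ?W"
  have fin: "finite A" if "A \<in> U \<or> A = x" for A
    by (rule finite_subset[OF _ assms(1)]) (use that assms(2,5) in auto)
  have finW: "finite ?W"
    by (rule finite_subset[of _ "Pow X"]) (use assms(1,2) in auto)
  have "isotropic ?F"
    by (rule isotropic_Un_translate)
      (use assms fin isotropic_subset[OF assms(3), of ?W] in \<open>auto simp: Int_commute\<close>)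
  moreover have "?F \<subseteq> Pow X" using assms(2,5) by blast
  moreover have "card ?F = 2 * card ?W"
  proof -
    \<comment> \<open>Otherwise \<open>x\<close>, the sum of \<open>A\<close> and
      \<open>sym_diff A x\<close>, is orthogonal to all of \<open>U\<close> and could be adjoined,
      against maximality.\<close>
    have "sym_diff A x \<notin> U" if A: "A \<in> U" for A
    proof
      assume D: "sym_diff A x \<in> U"
      have xU: "even (card (x \<inter> B))" if "B \<in> U" for B
        using even_card_sym_diff_Int[of A x B] fin A isotropicD[OF assms(3) D that]
          isotropicD[OF assms(3) A that] by auto
      have "isotropic (insert x U)"
        using assms(3,6) xU by (auto simp: isotropic_def Int_commute)
      then show False using max[of "insert x U"] assms by blast
    qed
    then have "?W \<inter> (\<lambda>A. sym_diff A x) ` ?W = {}" by blast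
    then show ?thesis
      using finW by (simp add: card_Un_disjoint card_image inj_on_subset[OF inj_sym_diff])
  qed
  ultimately show ?thesis using eventown[OF assms(1), of ?F] by simp
qed

lemma op_count_ge_of_isotropic:
  assumes "finite X" "\<A> \<subseteq> Pow X" "\<forall>A\<in>\<A>. even (card A)"
    and "card X div 2 = Suc j" "card \<A> = 2 * 2 ^ j + s"
    and "Z \<subseteq> \<A>" "isotropic Z" "2 ^ j + s \<le> card Z"
  shows "s * 2 ^ j \<le> op_count \<A>"
proof -
  have fin: "finite \<A>" using assms(1,2) finite_subset_Pow by blast
  obtain U where U: "Z \<subseteq> U" "U \<subseteq> Pow X" "isotropic U"
    "\<And>V. U \<subseteq> V \<Longrightarrow> V \<subseteq> Pow X \<Longrightarrow> isotropic V \<Longrightarrow> V = U"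
    by (rule maximal_isotropic[OF assms(1) subset_trans[OF assms(6,2)] assms(7)]) blast
  let ?B = "\<A> \<inter> U"
  define u where "u = card ?B"
  have finU: "finite U" using U(2) assms(1) finite_subset_Pow by blast
  have "card Z \<le> u" unfolding u_def
    by (rule card_mono) (use fin U assms(6) in auto)
  have "u \<le> card U" unfolding u_def by (rule card_mono) (use finU in auto)
  also have "\<dots> \<le> 2 * 2 ^ j" using eventown[OF assms(1) U(2,3)] assms(4) by simp
  finally have u: "2 ^ j + s \<le> u" "u \<le> 2 * 2 ^ j"
    using \<open>card Z \<le> u\<close> assms(8) by auto
  have "u - 2 ^ j \<le> card {B \<in> ?B. odd (card (A \<inter> B))}" if A: "A \<in> \<A> - ?B" for A
  proof -
    let ?E = "{B \<in> U. even (card (A \<inter> B))}" and ?O = "{B \<in> ?B. odd (card (A \<inter> B))}"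
    have "2 * card ?E \<le> 2 ^ (card X div 2)"
      by (rule card_orthogonal_maximal_isotropic[OF assms(1) U(2-4)]) (use assms(2,3) A in auto)
    then have "card ?E \<le> 2 ^ j" using assms(4) by simp
    moreover have "u \<le> card (?E \<union> ?O)" unfolding u_def
      by (rule card_mono) (use finU in auto)
    moreover have "card (?E \<union> ?O) \<le> card ?E + card ?O" by (rule card_Un_le)
    ultimately show ?thesis by linarith
  qed
  then have "card (\<A> - ?B) * (u - 2 ^ j) \<le> op_count \<A>"
    by (intro op_count_ge_cross_degrees) (use fin in auto)
  moreover have "card (\<A> - ?B) = 2 * 2 ^ j + s - u"
    using fin assms(5) by (simp add: card_Diff_subset u_def)
  \<comment> \<open>The right side is concave in \<open>u\<close> and equals \<open>s * K\<close> at
    both ends \<open>u = K + s\<close> and \<open>u = 2 * K\<close>; in the variables below the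
    excess is exactly \<open>p * q\<close>.\<close>
  moreover have "s * 2 ^ j \<le> (2 * 2 ^ j + s - u) * (u - 2 ^ j)"
  proof -
    define K :: nat where "K = 2 ^ j"
    obtain p where p: "u = K + s + p" using u(1) K_def le_Suc_ex by blast
    moreover obtain q where q: "K = s + p + q" using u(2) p K_def le_Suc_ex[of "s + p" K] by auto
    ultimately show ?thesis
      unfolding K_def[symmetric] by (simp add: algebra_simps)
  qed
  ultimately show ?thesis by simp
qed

section \<open>Excluding matched pairs, and assembly\<close>

text \<open>Few odd pairs allow few deletions, which keeps \<open>z\<close> large, whereas each
  matched pair halves the bound on \<open>z\<close>.\<close>

lemma matching_empty:
  fixes K m r z s e :: nat
  assumes "s \<in> {1, 2}" "e < s * K" "2 * r + m \<le> e" "z + r + 2 * m = 2 * K + s"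
    and "2 ^ m * z \<le> 2 * K" "2 ^ m \<le> 2 * K"
  shows "m = 0"
proof (rule ccontr)
  assume "m \<noteq> 0"
  \<comment> \<open>Eliminating \<open>r\<close> gives
    \<open>2 * z + 3 * m \<ge> (4 - s) * K + 2 * s + 1\<close>; the alternatives are
    \<open>s = 2\<close> and \<open>s = 1\<close>.\<close>
  have lin: "2 * K + 5 \<le> 2 * z + 3 * m \<or> 3 * K + 3 \<le> 2 * z + 3 * m"
    using assms(1-4) by auto
  consider "m = 1" | "m = 2" | "m = 3" | "m \<ge> 4" using \<open>m \<noteq> 0\<close> by linarith
  then show False
  proof cases
    case 4
    \<comment> \<open>This yields \<open>4 * z + 6 * m \<le> 4 * K + 9\<close>, one short of twice
      the first alternative; \<open>K \<ge> 8\<close> excludes the second.\<close>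
    have "6 * m \<le> 2 ^ m + 9" using 4
      by (induction m rule: dec_induct) auto
    moreover have "4 * z \<le> 2 ^ m * z"
      using 4 power_increasing[of 2 m "2::nat"] by (intro mult_le_mono1) auto
    moreover have "(16::nat) \<le> 2 ^ m"
      using power_increasing[OF 4, of "2::nat"] by simp
    ultimately show False using lin assms(5,6) by linarith
  qed (use lin assms(5,6) in auto)
qed

theorem theorem1:
  fixes n s :: nat and \<A> :: "nat set set"
  assumes "n \<ge> 1"
    and "s \<in> {1, 2}"
    and "\<A> \<subseteq> Pow {1..n}"
    and "\<forall>A\<in>\<A>. even (card A)"
    and "card \<A> \<ge> 2 ^ (n div 2) + s"
  shows "real (op_count \<A>) \<ge> real s * 2 powi (int (n div 2) - 1)"
proof (cases "n div 2")
  case 0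
  \<comment> \<open>The exponent is \<open>-1\<close> here, but the only even subset of
    \<open>{1}\<close> is empty, so the size hypothesis fails.\<close>
  then have "n = 1" using assms(1) by linarith
  then have "\<A> \<subseteq> {{}}" using assms(3,4) by (fastforce simp: subset_singleton_iff)
  then have "card \<A> \<le> 1" using card_mono[of "{{}}" \<A>] by simp
  then show ?thesis using assms(2,5) 0 by auto
next
  case (Suc j)
  obtain \<B> where B: "\<B> \<subseteq> \<A>" "card \<B> = 2 * 2 ^ j + s" "finite \<B>"
    using obtain_subset_with_card_n[OF assms(5)] Suc by (metis power_Suc)
  have BX: "\<B> \<subseteq> Pow {1..n}" "\<forall>A\<in>\<B>. even (card A)" using B(1) assms(3,4) by auto
  have "s * 2 ^ j \<le> op_count \<B>"
  proof (rule ccontr)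
    assume less: "\<not> s * 2 ^ j \<le> op_count \<B>"
    obtain r m Z where Z: "2 * r + m \<le> op_count \<B>" "card Z + r + 2 * m = card \<B>"
      "Z \<subseteq> \<B>" "isotropic Z" "2 ^ m * card Z \<le> 2 ^ (n div 2)" "(2::nat) ^ m \<le> 2 ^ (n div 2)"
      using isotropic_subfamily[OF _ BX] by auto
    have "m = 0"
      by (rule matching_empty[of s "op_count \<B>" "2 ^ j" r m "card Z"])
        (use less Z B Suc assms(2) in auto)
    \<comment> \<open>From \<open>2 * r < s * 2 ^ j\<close> and \<open>s \<le> 2\<close> follows
      \<open>r < 2 ^ j\<close>.\<close>
    then have "2 ^ j + s \<le> card Z" using Z(1,2) B(2) less assms(2) by auto
    then show False
      using op_count_ge_of_isotropic[OF _ BX _ B(2) Z(3,4)] Suc less by simp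
  qed
  also have "\<dots> \<le> op_count \<A>"
    using finite_subset_Pow[OF _ assms(3)] B(1) by (intro op_count_mono) auto
  finally have "real (s * 2 ^ j) \<le> real (op_count \<A>)" by (rule of_nat_mono)
  then show ?thesis using Suc by simp
qed

end
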